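(* Let $k$ be a field, let $Q$ be an arbitrary quiver, and consider the representation $\mathcal{F}$ of the Leavitt path algebra $L_k(Q)$ on the vector space with basis the set $Q_\infty$ of left-infinite paths. Then the following statements hold. (1) For each tail-equivalence class $[p]\in \widetilde{Q}_\infty$, the subspace $\mathcal{F}_{[p]}\subseteq \mathcal{F}$ is an irreducible subrepresentation, and it satisfies ${\rm End}_{L_k(Q)}(\mathcal{F}_{[p]})\simeq k$. (2) For $[p],[q]\in\widetilde{Q}_\infty$, the two representations $\mathcal{F}_{[p]}$ and $\mathcal{F}_{[q]}$ are isomorphic if and only if $[p]=[q]$.
   Context: A quiver $Q=(Q_0,Q_1;s,t)$ consists of a set $Q_0$ of vertices, a set $Q_1$ of arrows and maps $s,t\colon Q_1\to Q_0$ (starting and terminating vertex). A vertex is a sink if no arrow starts at it, an infinite emitter if infinitely many arrows start at it, and regular if it is neither. Leavitt path algebra: $L_k(Q)$ is the $k$-algebra (algebras are not required to be unital) given by generators $\{e_i,\alpha,\alpha^*\mid i\in Q_0,\alpha\in Q_1\}$ subject to: (0) $e_ie_j=\delta_{ij}e_i$ for $i,j\in Q_0$; (1) $e_{t(\alpha)}\alpha=\alpha=\alpha e_{s(\alpha)}$; (2) $e_{s(\alpha)}\alpha^*=\alpha^*=\alpha^*e_{t(\alpha)}$; (3) $\alpha\beta^*=\delta_{\alpha,\beta}e_{t(\alpha)}$ for $\alpha,\beta\in Q_1$; (4) $\sum_{\{\alpha\in Q_1\mid s(\alpha)=i\}}\alpha^*\alpha=e_i$ for every regular vertex $i$. A representation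 of $L_k(Q)$ is a $k$-vector space $M$ with an algebra homomorphism $L_k(Q)\to{\rm End}_k(M)$; it is irreducible if it is nonzero and has no subrepresentations other than $0$ and itself. A left-infinite path is an infinite sequence $p=\cdots\alpha_n\cdots\alpha_2\alpha_1$ of arrows with $t(\alpha_i)=s(\alpha_{i+1})$ for all $i\ge1$; $s(p)=s(\alpha_1)$. $Q_\infty$ is the set of left-infinite paths. For $n\ge 0$, $\tau_{>n}(p)=\cdots\alpha_{n+2}\alpha_{n+1}$ (so $\tau_{>0}(p)=p$). For an arrow $\alpha$ with $t(\alpha)=s(p)$, $p\alpha=\cdots\alpha_2\alpha_1\alpha$ denotes the concatenation. Two left-infinite paths $p,q$ are tail-equivalent if $\tau_{>n}(p)=\tau_{>m}(q)$ for some $n,m\ge0$; this is an equivalence relation, $[p]$ is the class of $p$, and $\widetilde{Q}_\infty$ is the set of classes. $\mathcal{F}$ is the $k$-vector space with basis $Q_\infty$; $L_k(Q)$ acts on it as follows, for $p=\cdots\alpha_2\alpha_1\in Q_\infty$: $e_i.p=\delta_{i,s(p)}p$; $\alpha.p=\delta_{\alpha,\alpha_1}\tau_{>1}(p)$; $\alpha^*.p=p\alpha$ if $t(\alpha)=s(p)$ and $\alpha^*.p=0$ otherwise. $\mathcal{F}_{[p]}$ is the subspace of $\mathcal{F}$ spanned by $\{q\mid q\in[p]\}$. *)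

theory Defs
  imports
    Complex_Main
    "HOL-Library.FuncSet"
    "HOL-Library.Poly_Mapping"
    "HOL-Library.Stream"
    "Graph_Theory.Digraph"
begin

section \<open>Vector spaces with a given basis\<close>

text \<open>
  Finitely supported functions \<open>'b \<Rightarrow>\<^sub>0 'k\<close> are the vector space with basis \<open>'b\<close>; the
  space with basis a set \<open>B\<close> is the subspace of functions supported in \<open>B\<close>.
\<close>

definition fscale :: "'k::field \<Rightarrow> ('b \<Rightarrow>\<^sub>0 'k) \<Rightarrow> ('b \<Rightarrow>\<^sub>0 'k)" where
  "fscale c f = Poly_Mapping.map ((*) c) f"

definition free_space :: "'b set \<Rightarrow> ('b \<Rightarrow>\<^sub>0 'k::field) set" where
  "free_space B = {f. Poly_Mapping.keys f \<subseteq> B}"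

definition basis_vec :: "'b \<Rightarrow> ('b \<Rightarrow>\<^sub>0 'k::field)" where
  "basis_vec b = Poly_Mapping.single b 1"

definition lin_ext :: "('b \<Rightarrow> ('c \<Rightarrow>\<^sub>0 'k::field)) \<Rightarrow> ('b \<Rightarrow>\<^sub>0 'k) \<Rightarrow> ('c \<Rightarrow>\<^sub>0 'k)" where
  "lin_ext g f = (\<Sum>b\<in>Poly_Mapping.keys f. fscale (Poly_Mapping.lookup f b) (g b))"

lemma lookup_fscale [simp]:
  "Poly_Mapping.lookup (fscale c f) b = c * Poly_Mapping.lookup f b"
  unfolding fscale_def by (simp add: Poly_Mapping.map.rep_eq when_def)

interpretation fvs: vector_space "fscale :: 'k::field \<Rightarrow> ('b \<Rightarrow>\<^sub>0 'k) \<Rightarrow> ('b \<Rightarrow>\<^sub>0 'k)"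
  by unfold_locales (auto intro!: poly_mapping_eqI simp: lookup_add algebra_simps)

section \<open>Algebras and their representations\<close>

text \<open>
  Algebras are associative but need not have a unit, so homomorphisms are not
  required to preserve one, even when both sides happen to be unital.
\<close>

record ('k, 'x) nu_alg =
  acarrier :: "'x set"
  aadd :: "'x \<Rightarrow> 'x \<Rightarrow> 'x"
  amult :: "'x \<Rightarrow> 'x \<Rightarrow> 'x"
  ascale :: "'k \<Rightarrow> 'x \<Rightarrow> 'x"

definition alg_hom :: "('k, 'x) nu_alg \<Rightarrow> ('k, 'y) nu_alg \<Rightarrow> ('x \<Rightarrow> 'y) set" where
  "alg_hom A B = {h \<in> acarrier A \<rightarrow> acarrier B.
     (\<forall>x\<in>acarrier A. \<forall>y\<in>acarrier A. h (aadd A x y) = aadd B (h x) (h y)) \<and>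
     (\<forall>x\<in>acarrier A. \<forall>y\<in>acarrier A. h (amult A x y) = amult B (h x) (h y)) \<and>
     (\<forall>c. \<forall>x\<in>acarrier A. h (ascale A c x) = ascale B c (h x))}"

definition alg_isomorphic :: "('k, 'x) nu_alg \<Rightarrow> ('k, 'y) nu_alg \<Rightarrow> bool" where
  "alg_isomorphic A B \<longleftrightarrow> (\<exists>h\<in>alg_hom A B. bij_betw h (acarrier A) (acarrier B))"

definition field_alg :: "('k::field, 'k) nu_alg" where
  "field_alg = \<lparr>acarrier = UNIV, aadd = (+), amult = (*), ascale = (*)\<rparr>"

text \<open>
  Linear maps between subspaces are taken to be extensional, so that equality in
  \<open>End_alg\<close> is equality of maps on \<open>M\<close>.
\<close>

definition lin_maps ::
    "('k \<Rightarrow> 'm::ab_group_add \<Rightarrow> 'm) \<Rightarrow> 'm set \<Rightarrow> ('k \<Rightarrow> 'n::ab_group_add \<Rightarrow> 'n) \<Rightarrow> 'n set \<Rightarrow> ('m \<Rightarrow> 'n) set" where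
  "lin_maps s M s' N = {\<phi> \<in> M \<rightarrow>\<^sub>E N.
     (\<forall>x\<in>M. \<forall>y\<in>M. \<phi> (x + y) = \<phi> x + \<phi> y) \<and> (\<forall>c. \<forall>x\<in>M. \<phi> (s c x) = s' c (\<phi> x))}"

definition End_alg :: "('k \<Rightarrow> 'm::ab_group_add \<Rightarrow> 'm) \<Rightarrow> 'm set \<Rightarrow> ('k, 'm \<Rightarrow> 'm) nu_alg" where
  "End_alg s M = \<lparr>acarrier = lin_maps s M s M,
     aadd = (\<lambda>\<phi> \<psi>. \<lambda>x\<in>M. \<phi> x + \<psi> x),
     amult = (\<lambda>\<phi> \<psi>. compose M \<phi> \<psi>),
     ascale = (\<lambda>c \<phi>. \<lambda>x\<in>M. s c (\<phi> x))\<rparr>"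

text \<open>
  The underlying vector space of a representation is the subspace \<open>rspace\<close> of the ambient
  space given by \<open>rscale\<close>; \<open>ract\<close> matters only on the carrier of the algebra.
\<close>

record ('k, 'x, 'm) rep =
  rscale :: "'k \<Rightarrow> 'm \<Rightarrow> 'm"
  rspace :: "'m set"
  ract :: "'x \<Rightarrow> 'm \<Rightarrow> 'm"

definition is_rep :: "('k::field, 'x) nu_alg \<Rightarrow> ('k, 'x, 'm::ab_group_add) rep \<Rightarrow> bool" where
  "is_rep A V \<longleftrightarrow> vector_space (rscale V) \<and> module.subspace (rscale V) (rspace V) \<and>
     ract V \<in> alg_hom A (End_alg (rscale V) (rspace V))"

definition is_subrep ::
    "('k::field, 'x) nu_alg \<Rightarrow> ('k, 'x, 'm::ab_group_add) rep \<Rightarrow> 'm set \<Rightarrow> bool" where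
  "is_subrep A V N \<longleftrightarrow> is_rep A V \<and> module.subspace (rscale V) N \<and> N \<subseteq> rspace V \<and>
     (\<forall>a\<in>acarrier A. \<forall>x\<in>N. ract V a x \<in> N)"

definition subrep :: "('k, 'x, 'm) rep \<Rightarrow> 'm set \<Rightarrow> ('k, 'x, 'm) rep" where
  "subrep V N = \<lparr>rscale = rscale V, rspace = N, ract = (\<lambda>a. restrict (ract V a) N)\<rparr>"

definition irreducible_rep ::
    "('k::field, 'x) nu_alg \<Rightarrow> ('k, 'x, 'm::ab_group_add) rep \<Rightarrow> bool" where
  "irreducible_rep A V \<longleftrightarrow> is_rep A V \<and> rspace V \<noteq> {0} \<and>
     (\<forall>N. is_subrep A V N \<longrightarrow> N = {0} \<or> N = rspace V)"

definition rep_homs ::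
    "('k, 'x) nu_alg \<Rightarrow> ('k, 'x, 'm::ab_group_add) rep \<Rightarrow> ('k, 'x, 'n::ab_group_add) rep \<Rightarrow> ('m \<Rightarrow> 'n) set" where
  "rep_homs A V W = {\<phi> \<in> lin_maps (rscale V) (rspace V) (rscale W) (rspace W).
     \<forall>a\<in>acarrier A. \<forall>x\<in>rspace V. \<phi> (ract V a x) = ract W a (\<phi> x)}"

definition rep_isomorphic ::
    "('k, 'x) nu_alg \<Rightarrow> ('k, 'x, 'm::ab_group_add) rep \<Rightarrow> ('k, 'x, 'n::ab_group_add) rep \<Rightarrow> bool" where
  "rep_isomorphic A V W \<longleftrightarrow> (\<exists>\<phi>\<in>rep_homs A V W. bij_betw \<phi> (rspace V) (rspace W))"

definition rep_End ::
    "('k, 'x) nu_alg \<Rightarrow> ('k, 'x, 'm::ab_group_add) rep \<Rightarrow> ('k, 'm \<Rightarrow> 'm) nu_alg" where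
  "rep_End A V = (End_alg (rscale V) (rspace V))\<lparr>acarrier := rep_homs A V V\<rparr>"

section \<open>Algebras given by generators and relations\<close>

text \<open>
  Words form a monoid under concatenation, so the convolution product of
  \<open>Poly_Mapping\<close> on \<open>'g word \<Rightarrow>\<^sub>0 'k\<close> is the multiplication of the free associative algebra.
  The free non-unital algebra is the subspace spanned by the nonempty words.
\<close>

datatype 'g word = Word (letters: "'g list")

instantiation word :: (type) monoid_add
begin
definition zero_word :: "'a word" where "zero_word = Word []"
definition plus_word :: "'a word \<Rightarrow> 'a word \<Rightarrow> 'a word" where
  "plus_word u v = Word (letters u @ letters v)"
instance by standard (auto simp: zero_word_def plus_word_def)
end

definition free_alg_carrier :: "'g set \<Rightarrow> ('g word \<Rightarrow>\<^sub>0 'k::field) set" where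
  "free_alg_carrier G = free_space {w. letters w \<in> lists G \<and> letters w \<noteq> []}"

inductive_set gen_ideal ::
    "'g set \<Rightarrow> ('g word \<Rightarrow>\<^sub>0 'k::field) set \<Rightarrow> ('g word \<Rightarrow>\<^sub>0 'k) set"
  for G R where
  zero: "0 \<in> gen_ideal G R"
| relator: "r \<in> R \<Longrightarrow> r \<in> gen_ideal G R"
| add: "x \<in> gen_ideal G R \<Longrightarrow> y \<in> gen_ideal G R \<Longrightarrow> x + y \<in> gen_ideal G R"
| scale: "x \<in> gen_ideal G R \<Longrightarrow> fscale c x \<in> gen_ideal G R"
| left: "a \<in> free_alg_carrier G \<Longrightarrow> x \<in> gen_ideal G R \<Longrightarrow> a * x \<in> gen_ideal G R"
| right: "a \<in> free_alg_carrier G \<Longrightarrow> x \<in> gen_ideal G R \<Longrightarrow> x * a \<in> gen_ideal G R"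

definition pres_cong ::
    "'g set \<Rightarrow> ('g word \<Rightarrow>\<^sub>0 'k::field) set \<Rightarrow> (('g word \<Rightarrow>\<^sub>0 'k) \<times> ('g word \<Rightarrow>\<^sub>0 'k)) set" where
  "pres_cong G R = {(x, y). x \<in> free_alg_carrier G \<and> y \<in> free_alg_carrier G \<and> x - y \<in> gen_ideal G R}"

definition presented_alg ::
    "'g set \<Rightarrow> ('g word \<Rightarrow>\<^sub>0 'k::field) set \<Rightarrow> ('k, ('g word \<Rightarrow>\<^sub>0 'k) set) nu_alg" where
  "presented_alg G R =
    \<lparr>acarrier = free_alg_carrier G // pres_cong G R,
     aadd = (\<lambda>X Y. \<Union>x\<in>X. \<Union>y\<in>Y. pres_cong G R `` {x + y}),
     amult = (\<lambda>X Y. \<Union>x\<in>X. \<Union>y\<in>Y. pres_cong G R `` {x * y}),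
     ascale = (\<lambda>c X. \<Union>x\<in>X. pres_cong G R `` {fscale c x})\<rparr>"

section \<open>The Leavitt path algebra\<close>

text \<open>
  A quiver is a \<open>wf_digraph\<close> (possibly infinite, loops and multiple arrows allowed):
  \<open>verts\<close> and \<open>arcs\<close> are the vertices and arrows, \<open>tail\<close> is the starting and \<open>head\<close> the
  terminating vertex.  \<open>Ghost \<alpha>\<close> is the generator written \<open>\<alpha>\<^sup>*\<close>.
\<close>

datatype ('v, 'a) lgen = Vtx 'v | Arr 'a | Ghost 'a

definition out_arrows :: "('v, 'a) pre_digraph \<Rightarrow> 'v \<Rightarrow> 'a set" where
  "out_arrows Q i = {\<alpha> \<in> arcs Q. tail Q \<alpha> = i}"

definition is_sink :: "('v, 'a) pre_digraph \<Rightarrow> 'v \<Rightarrow> bool" where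
  "is_sink Q i \<longleftrightarrow> out_arrows Q i = {}"

definition infinite_emitter :: "('v, 'a) pre_digraph \<Rightarrow> 'v \<Rightarrow> bool" where
  "infinite_emitter Q i \<longleftrightarrow> infinite (out_arrows Q i)"

definition regular_vertex :: "('v, 'a) pre_digraph \<Rightarrow> 'v \<Rightarrow> bool" where
  "regular_vertex Q i \<longleftrightarrow> i \<in> verts Q \<and> \<not> is_sink Q i \<and> \<not> infinite_emitter Q i"

definition leavitt_gens :: "('v, 'a) pre_digraph \<Rightarrow> ('v, 'a) lgen set" where
  "leavitt_gens Q = Vtx ` verts Q \<union> Arr ` arcs Q \<union> Ghost ` arcs Q"

abbreviation word_vec :: "'g list \<Rightarrow> ('g word \<Rightarrow>\<^sub>0 'k::field)" where
  "word_vec gs \<equiv> basis_vec (Word gs)"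

definition leavitt_relators ::
    "('v, 'a) pre_digraph \<Rightarrow> (('v, 'a) lgen word \<Rightarrow>\<^sub>0 'k::field) set" where
  "leavitt_relators Q =
     {word_vec [Vtx i, Vtx j] - (if i = j then word_vec [Vtx i] else 0) | i j. i \<in> verts Q \<and> j \<in> verts Q}
   \<union> {word_vec [Vtx (head Q \<alpha>), Arr \<alpha>] - word_vec [Arr \<alpha>] | \<alpha>. \<alpha> \<in> arcs Q}
   \<union> {word_vec [Arr \<alpha>] - word_vec [Arr \<alpha>, Vtx (tail Q \<alpha>)] | \<alpha>. \<alpha> \<in> arcs Q}
   \<union> {word_vec [Vtx (tail Q \<alpha>), Ghost \<alpha>] - word_vec [Ghost \<alpha>] | \<alpha>. \<alpha> \<in> arcs Q}
   \<union> {word_vec [Ghost \<alpha>] - word_vec [Ghost \<alpha>, Vtx (head Q \<alpha>)] | \<alpha>. \<alpha> \<in> arcs Q}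
   \<union> {word_vec [Arr \<alpha>, Ghost \<beta>] - (if \<alpha> = \<beta> then word_vec [Vtx (head Q \<alpha>)] else 0) | \<alpha> \<beta>.
        \<alpha> \<in> arcs Q \<and> \<beta> \<in> arcs Q}
   \<union> {(\<Sum>\<alpha>\<in>out_arrows Q i. word_vec [Ghost \<alpha>, Arr \<alpha>]) - word_vec [Vtx i] | i. regular_vertex Q i}"

definition leavitt ::
    "('v, 'a) pre_digraph \<Rightarrow> ('k::field, (('v, 'a) lgen word \<Rightarrow>\<^sub>0 'k) set) nu_alg" where
  "leavitt Q = presented_alg (leavitt_gens Q) (leavitt_relators Q)"

section \<open>Left-infinite paths and the representation on them\<close>

text \<open>
  The path \<open>\<cdots>\<alpha>\<^sub>2\<alpha>\<^sub>1\<close> is the stream with \<open>\<alpha>\<^sub>1\<close> as its first element: \<open>shd p\<close> is \<open>\<alpha>\<^sub>1\<close>,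
  \<open>sdrop n p\<close> is \<open>\<tau>\<^sub>>\<^sub>n(p)\<close>, and \<open>\<alpha> ## p\<close> is \<open>p\<alpha>\<close>.
\<close>

definition inf_paths :: "('v, 'a) pre_digraph \<Rightarrow> 'a stream set" where
  "inf_paths Q = {p. sset p \<subseteq> arcs Q \<and> (\<forall>n. head Q (p !! n) = tail Q (p !! Suc n))}"

definition path_source :: "('v, 'a) pre_digraph \<Rightarrow> 'a stream \<Rightarrow> 'v" where
  "path_source Q p = tail Q (shd p)"

definition tail_equiv :: "('v, 'a) pre_digraph \<Rightarrow> ('a stream \<times> 'a stream) set" where
  "tail_equiv Q = {(p, q). p \<in> inf_paths Q \<and> q \<in> inf_paths Q \<and> (\<exists>n m. sdrop n p = sdrop m q)}"

definition tail_classes :: "('v, 'a) pre_digraph \<Rightarrow> 'a stream set set" where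
  "tail_classes Q = inf_paths Q // tail_equiv Q"

fun gen_act :: "('v, 'a) pre_digraph \<Rightarrow> ('v, 'a) lgen \<Rightarrow> 'a stream \<Rightarrow> ('a stream \<Rightarrow>\<^sub>0 'k::field)" where
  "gen_act Q (Vtx i) p = (if i = path_source Q p then basis_vec p else 0)"
| "gen_act Q (Arr \<alpha>) p = (if \<alpha> = shd p then basis_vec (stl p) else 0)"
| "gen_act Q (Ghost \<alpha>) p = (if head Q \<alpha> = path_source Q p then basis_vec (\<alpha> ## p) else 0)"

text \<open>
  The first letter of a word acts last, as befits a left action.
\<close>

definition word_act ::
    "('v, 'a) pre_digraph \<Rightarrow> ('v, 'a) lgen word \<Rightarrow> ('a stream \<Rightarrow>\<^sub>0 'k::field) \<Rightarrow> ('a stream \<Rightarrow>\<^sub>0 'k)" where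
  "word_act Q w = foldr (\<lambda>g. lin_ext (gen_act Q g)) (letters w)"

definition free_act ::
    "('v, 'a) pre_digraph \<Rightarrow> (('v, 'a) lgen word \<Rightarrow>\<^sub>0 'k::field) \<Rightarrow> ('a stream \<Rightarrow>\<^sub>0 'k) \<Rightarrow> ('a stream \<Rightarrow>\<^sub>0 'k)" where
  "free_act Q x f = lin_ext (\<lambda>w. word_act Q w f) x"

definition path_rep ::
    "('v, 'a) pre_digraph \<Rightarrow> ('k::field, (('v, 'a) lgen word \<Rightarrow>\<^sub>0 'k) set, 'a stream \<Rightarrow>\<^sub>0 'k) rep" where
  "path_rep Q =
    \<lparr>rscale = fscale,
     rspace = free_space (inf_paths Q),
     ract = (\<lambda>X. the_elem ((\<lambda>x. restrict (free_act Q x) (free_space (inf_paths Q))) ` X))\<rparr>"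

definition class_space :: "'a stream set \<Rightarrow> ('a stream \<Rightarrow>\<^sub>0 'k::field) set" where
  "class_space c = module.span fscale (basis_vec ` c)"

definition class_rep ::
    "('v, 'a) pre_digraph \<Rightarrow> 'a stream set \<Rightarrow> ('k::field, (('v, 'a) lgen word \<Rightarrow>\<^sub>0 'k) set, 'a stream \<Rightarrow>\<^sub>0 'k) rep" where
  "class_rep Q c = subrep (path_rep Q) (class_space c)"

section \<open>The action is well defined\<close>

text \<open>
  \<open>path_rep_is_rep\<close> and \<open>path_rep_gen\<close> show that the action descends to the quotient
  (so \<open>the_elem\<close> is applied to singletons only) and that the generators act on paths as
  prescribed by \<open>gen_act\<close>.
\<close>

lemma lin_ext_superset:
  assumes "finite S" "Poly_Mapping.keys f \<subseteq> S"
  shows "lin_ext g f = (\<Sum>b\<in>S. fscale (Poly_Mapping.lookup f b) (g b))"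
  unfolding lin_ext_def
  by (rule sum.mono_neutral_left) (use assms in \<open>auto simp: in_keys_iff\<close>)

lemma keys_fscale: "Poly_Mapping.keys (fscale c f) \<subseteq> Poly_Mapping.keys f"
  by (auto simp: in_keys_iff)

lemma lin_ext_zero [simp]: "lin_ext g 0 = 0"
  by (simp add: lin_ext_def)

lemma lin_ext_basis_vec [simp]: "lin_ext g (basis_vec b) = g b"
  by (simp add: lin_ext_def basis_vec_def)

lemma lin_ext_add: "lin_ext g (f + h) = lin_ext g f + lin_ext g h"
proof -
  let ?S = "Poly_Mapping.keys f \<union> Poly_Mapping.keys h"
  have "Poly_Mapping.keys (f + h) \<subseteq> ?S" by (rule keys_add)
  then show ?thesis
    by (subst (1 2 3) lin_ext_superset[where S = ?S])
       (auto simp: lookup_add fvs.scale_left_distrib sum.distrib)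
qed

lemma lin_ext_scale: "lin_ext g (fscale c f) = fscale c (lin_ext g f)"
  by (subst (1 2) lin_ext_superset[where S = "Poly_Mapping.keys f"])
     (auto simp: keys_fscale fvs.scale_sum_right)

lemma lin_ext_diff: "lin_ext g (f - h) = lin_ext g f - lin_ext g h"
  using lin_ext_add[of g "f - h" h] by (simp add: algebra_simps)

lemma lin_ext_sum: "lin_ext g (sum f S) = (\<Sum>s\<in>S. lin_ext g (f s))"
  by (induction S rule: infinite_finite_induct) (auto simp: lin_ext_add)

lemma free_space_subspace: "fvs.subspace (free_space B)"
  by (rule fvs.subspaceI) (auto simp: free_space_def dest: subsetD[OF keys_add] subsetD[OF keys_fscale])

lemma basis_vec_in_free_space [simp]: "basis_vec b \<in> free_space B \<longleftrightarrow> b \<in> B"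
  by (auto simp: free_space_def basis_vec_def)

lemma basis_expansion: "lin_ext basis_vec f = f"
proof (rule poly_mapping_eqI)
  fix k
  have "Poly_Mapping.lookup (lin_ext basis_vec f) k =
      (\<Sum>b\<in>Poly_Mapping.keys f. if b = k then Poly_Mapping.lookup f k else 0)"
    unfolding lin_ext_def lookup_sum
    by (rule sum.cong) (auto simp: basis_vec_def lookup_single)
  then show "Poly_Mapping.lookup (lin_ext basis_vec f) k = Poly_Mapping.lookup f k"
    by (simp add: sum.delta in_keys_iff)
qed

lemma free_space_induct [consumes 1, case_names zero basis scale add]:
  assumes "f \<in> free_space B" "P 0"
    and "\<And>b. b \<in> B \<Longrightarrow> P (basis_vec b)"
    and "\<And>c f. f \<in> free_space B \<Longrightarrow> P f \<Longrightarrow> P (fscale c f)"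
    and "\<And>f g. P f \<Longrightarrow> P g \<Longrightarrow> P (f + g)"
  shows "P f"
proof -
  have "P (\<Sum>b\<in>S. fscale (Poly_Mapping.lookup f b) (basis_vec b))" if "finite S" "S \<subseteq> B" for S
    using that by (induction S) (auto intro!: assms)
  from this[of "Poly_Mapping.keys f"] show ?thesis
    using assms(1) basis_expansion[of f] by (simp add: lin_ext_def free_space_def)
qed

lemma lin_ext_in:
  assumes "f \<in> free_space B" "\<And>b. b \<in> B \<Longrightarrow> g b \<in> free_space C"
  shows "lin_ext g f \<in> free_space C"
  using assms(1)
  by (induction rule: free_space_induct)
     (auto simp: assms(2) lin_ext_add lin_ext_scale
        intro: fvs.subspace_0 fvs.subspace_add fvs.subspace_scale free_space_subspace)

lemma free_space_UNIV: "f \<in> free_space UNIV"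
  by (simp add: free_space_def)

lemma word_act_linear:
  "word_act Q w (f + h) = word_act Q w f + word_act Q w h"
  "word_act Q w (fscale c f) = fscale c (word_act Q w f)"
  "word_act Q w 0 = 0"
proof -
  have "foldr (\<lambda>g. lin_ext (gen_act Q g)) gs (f + h) =
      foldr (\<lambda>g. lin_ext (gen_act Q g)) gs f + foldr (\<lambda>g. lin_ext (gen_act Q g)) gs h"
    "foldr (\<lambda>g. lin_ext (gen_act Q g)) gs (fscale c f) =
      fscale c (foldr (\<lambda>g. lin_ext (gen_act Q g)) gs f)"
    "foldr (\<lambda>g. lin_ext (gen_act Q g)) gs 0 = 0" for gs
    by (induction gs) (auto simp: lin_ext_add lin_ext_scale)
  then show "word_act Q w (f + h) = word_act Q w f + word_act Q w h"
  "word_act Q w (fscale c f) = fscale c (word_act Q w f)"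
  "word_act Q w 0 = 0" by (auto simp: word_act_def)
qed

lemma word_act_plus: "word_act Q (u + v) f = word_act Q u (word_act Q v f)"
  by (simp add: word_act_def plus_word_def)

lemma free_act_add: "free_act Q (x + y) f = free_act Q x f + free_act Q y f"
  and free_act_diff: "free_act Q (x - y) f = free_act Q x f - free_act Q y f"
  and free_act_scale: "free_act Q (fscale c x) f = fscale c (free_act Q x f)"
  and free_act_zero [simp]: "free_act Q 0 f = 0"
  and free_act_basis [simp]: "free_act Q (basis_vec w) f = word_act Q w f"
  and free_act_sum: "free_act Q (sum g S) f = (\<Sum>s\<in>S. free_act Q (g s) f)"
  by (simp_all add: free_act_def lin_ext_add lin_ext_diff lin_ext_scale lin_ext_sum)

lemma free_act_add2: "free_act Q x (f + h) = free_act Q x f + free_act Q x h"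
  and free_act_scale2: "free_act Q x (fscale c f) = fscale c (free_act Q x f)"
  and free_act_zero2 [simp]: "free_act Q x 0 = 0"
  by (simp_all add: free_act_def lin_ext_def word_act_linear fvs.scale_right_distrib sum.distrib
     fvs.scale_sum_right mult.commute)

lemma basis_vec_mult: "basis_vec u * basis_vec v = basis_vec (u + v)"
  by (simp add: basis_vec_def mult_single)

lemma fscale_mult: "fscale c x * y = fscale c (x * y)" "x * fscale c y = fscale c (x * y)"
  for x y :: "'g word \<Rightarrow>\<^sub>0 'k::field"
proof -
  have *: "fscale c z = Poly_Mapping.single 0 c * z" for z :: "'g word \<Rightarrow>\<^sub>0 'k" and c
    by (simp add: fscale_def mult_map_scale_conv_mult)
  have left: "fscale c x * y = fscale c (x * y)" for x y :: "'g word \<Rightarrow>\<^sub>0 'k" and c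
    by (simp only: * mult.assoc)
  show "fscale c x * y = fscale c (x * y)" by (rule left)
  have bas: "fscale d (basis_vec u) = Poly_Mapping.single u d" for d :: 'k and u :: "'g word"
    by (simp add: * basis_vec_def mult_single)
  have bu: "basis_vec u * fscale c y = fscale c (basis_vec u * y)" for u
    using free_space_UNIV[of y]
  proof (induction rule: free_space_induct)
    case (add f g)
    then show ?case by (simp add: distrib_left fvs.scale_right_distrib)
  next
    case (basis v)
    then show ?case by (simp add: bas basis_vec_mult) (simp add: basis_vec_def mult_single)
  next
    case (scale d z)
    have bs: "basis_vec u * fscale d z = fscale d (basis_vec u * z)" for d :: 'k and z
    proof -
      have "basis_vec u * (Poly_Mapping.single 0 d :: 'g word \<Rightarrow>\<^sub>0 'k) = Poly_Mapping.single 0 d * basis_vec u"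
        by (simp add: basis_vec_def mult_single)
      then show ?thesis by (metis * mult.assoc)
    qed
    show ?case by (rule bs)
  qed simp
  show "x * fscale c y = fscale c (x * y)"
    using free_space_UNIV[of x]
    by (induction rule: free_space_induct)
       (simp_all add: bu distrib_right fvs.scale_right_distrib left mult.commute)
qed

lemma free_act_mult: "free_act Q (x * y) f = free_act Q x (free_act Q y f)"
  using free_space_UNIV[of x]
proof (induction rule: free_space_induct)
  case (basis u)
  show ?case using free_space_UNIV[of y]
    by (induction rule: free_space_induct)
       (auto simp: basis_vec_mult word_act_plus distrib_left free_act_add free_act_scale
          word_act_linear fscale_mult)
qed (auto simp: distrib_right free_act_add free_act_scale fscale_mult)

abbreviation path_space where "path_space Q \<equiv> free_space (inf_paths Q)"

lemma inf_paths_stl: "p \<in> inf_paths Q \<Longrightarrow> stl p \<in> inf_paths Q"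
  by (cases p) (auto simp: inf_paths_def dest: spec[of _ "Suc _"])

lemma inf_paths_Cons: "p \<in> inf_paths Q \<Longrightarrow> a \<in> arcs Q \<Longrightarrow> head Q a = path_source Q p
  \<Longrightarrow> a ## p \<in> inf_paths Q"
  apply (auto simp: inf_paths_def path_source_def)
  subgoal for n by (cases n) auto
  done

lemma inf_paths_head: "p \<in> inf_paths Q \<Longrightarrow> head Q (shd p) = path_source Q (stl p)"
  by (auto simp: inf_paths_def path_source_def dest: spec[of _ 0])

lemma inf_paths_shd: "p \<in> inf_paths Q \<Longrightarrow> shd p \<in> arcs Q"
  by (cases p) (auto simp: inf_paths_def)

lemma gen_act_in: "g \<in> leavitt_gens Q \<Longrightarrow> p \<in> inf_paths Q \<Longrightarrow> gen_act Q g p \<in> path_space Q"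
  by (cases g) (auto simp: leavitt_gens_def inf_paths_stl inf_paths_Cons
     intro: fvs.subspace_0 free_space_subspace)

lemma word_act_in:
  assumes "letters w \<in> lists (leavitt_gens Q)" "f \<in> path_space Q" shows "word_act Q w f \<in> path_space Q"
proof -
  have "foldr (\<lambda>g. lin_ext (gen_act Q g)) gs f \<in> path_space Q" if "gs \<in> lists (leavitt_gens Q)" for gs
    using that by (induction gs) (auto intro!: lin_ext_in gen_act_in assms)
  with assms show ?thesis by (auto simp: word_act_def)
qed

abbreviation "leavitt_free Q \<equiv> free_alg_carrier (leavitt_gens Q)"
abbreviation "leavitt_ideal Q \<equiv> gen_ideal (leavitt_gens Q) (leavitt_relators Q)"
abbreviation "leavitt_cong Q \<equiv> pres_cong (leavitt_gens Q) (leavitt_relators Q)"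

lemma free_act_in: "x \<in> leavitt_free Q \<Longrightarrow> f \<in> path_space Q \<Longrightarrow> free_act Q x f \<in> path_space Q"
  unfolding free_act_def free_alg_carrier_def
  by (erule lin_ext_in) (auto intro: word_act_in)

lemma word_act_Word: "word_act Q (Word []) f = f"
  "word_act Q (Word (g # gs)) f = lin_ext (gen_act Q g) (word_act Q (Word gs) f)"
  by (simp_all add: word_act_def)

lemma relator_act_basis:
  assumes "wf_digraph Q" "r \<in> leavitt_relators Q" "p \<in> inf_paths Q"
  shows "free_act Q r (basis_vec p :: _ \<Rightarrow>\<^sub>0 'k::field) = 0"
proof -
  note [simp] = free_act_diff free_act_sum word_act_Word
  have last: "(\<Sum>a\<in>out_arrows Q i. lin_ext (gen_act Q (Ghost a)) (gen_act Q (Arr a) p))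
      = (gen_act Q (Vtx i) p :: _ \<Rightarrow>\<^sub>0 'k)" if "regular_vertex Q i" for i
  proof -
    from that have fin: "finite (out_arrows Q i)"
      by (simp add: regular_vertex_def infinite_emitter_def)
    have "(\<Sum>a\<in>out_arrows Q i. lin_ext (gen_act Q (Ghost a)) (gen_act Q (Arr a) p))
       = (\<Sum>a\<in>out_arrows Q i. if a = shd p then basis_vec p else (0 :: _ \<Rightarrow>\<^sub>0 'k))"
      by (rule sum.cong) (auto simp: inf_paths_head[OF assms(3)])
    also have "\<dots> = gen_act Q (Vtx i) p"
      using fin inf_paths_shd[OF assms(3)] by (auto simp: sum.delta out_arrows_def path_source_def)
    finally show ?thesis .
  qed
  show ?thesis
    using assms(2) unfolding leavitt_relators_def Un_iff
    apply (elim disjE CollectE exE conjE)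
    apply (auto simp: path_source_def inf_paths_head[OF assms(3), unfolded path_source_def])
    using last by (auto simp: path_source_def)
qed

lemma relator_act:
  assumes "wf_digraph Q" "r \<in> leavitt_relators Q" "f \<in> path_space Q"
  shows "free_act Q r f = 0"
  using assms(3)
  by (induction rule: free_space_induct)
     (auto simp: relator_act_basis[OF assms(1,2)] free_act_add2 free_act_scale2)

lemma ideal_act:
  assumes "wf_digraph Q" "x \<in> leavitt_ideal Q" "f \<in> path_space Q"
  shows "free_act Q x f = 0"
  using assms(2,3)
  by (induction arbitrary: f rule: gen_ideal.induct)
     (auto simp: relator_act[OF assms(1)] free_act_add free_act_scale free_act_mult free_act_in)

lemma leavitt_free_ops:
  "x \<in> leavitt_free Q \<Longrightarrow> y \<in> leavitt_free Q \<Longrightarrow> x + y \<in> leavitt_free Q"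
  "x \<in> leavitt_free Q \<Longrightarrow> fscale c x \<in> leavitt_free Q"
  unfolding free_alg_carrier_def
  by (auto intro: fvs.subspace_add fvs.subspace_scale free_space_subspace)

lemma leavitt_free_mult:
  assumes "x \<in> leavitt_free Q" "y \<in> leavitt_free Q"
  shows "x * y \<in> leavitt_free Q"
proof -
  define W where "W = {w. letters w \<in> lists (leavitt_gens Q) \<and> letters w \<noteq> []}"
  have xy: "Poly_Mapping.keys x \<subseteq> W" "Poly_Mapping.keys y \<subseteq> W"
    using assms by (simp_all add: free_alg_carrier_def free_space_def W_def)
  have plus: "a + b \<in> W" if "a \<in> W" "b \<in> W" for a b
    using that by (simp add: plus_word_def W_def)
  have "w \<in> W" if w: "w \<in> Poly_Mapping.keys (x * y)" for w
  proof -
    obtain a b where ab: "w = a + b" "a \<in> Poly_Mapping.keys x" "b \<in> Poly_Mapping.keys y"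
      using subsetD[OF keys_mult w] unfolding mem_Collect_eq by (elim exE conjE)
    show ?thesis
      unfolding ab(1) by (rule plus[OF subsetD[OF xy(1) ab(2)] subsetD[OF xy(2) ab(3)]])
  qed
  then have "Poly_Mapping.keys (x * y) \<subseteq> W" by (rule subsetI)
  then show ?thesis by (simp add: free_alg_carrier_def free_space_def W_def)
qed

lemma ideal_uminus: "x \<in> gen_ideal G R \<Longrightarrow> - x \<in> gen_ideal G R"
  using gen_ideal.scale[of x G R "-1"] by simp

lemma equiv_pres_cong: "equiv (free_alg_carrier G) (pres_cong G R)"
proof (rule equivI)
  show "pres_cong G R \<subseteq> free_alg_carrier G \<times> free_alg_carrier G" by (auto simp: pres_cong_def)
  show "refl_on (free_alg_carrier G) (pres_cong G R)"
    by (auto simp: refl_on_def pres_cong_def gen_ideal.zero)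
  show "sym (pres_cong G R)"
    by (auto simp: sym_def pres_cong_def dest: ideal_uminus)
  show "trans (pres_cong G R)"
    by (auto simp: trans_def pres_cong_def dest: gen_ideal.add)
qed

lemma image_singletonI: "(\<And>y. y \<in> S \<Longrightarrow> h y = a) \<Longrightarrow> x \<in> S \<Longrightarrow> h ` S = {a}"
  by blast

lemma ract_class:
  assumes "wf_digraph Q" "x \<in> leavitt_free Q"
  shows "ract (path_rep Q) (leavitt_cong Q `` {x}) = restrict (free_act Q x) (path_space Q)"
proof -
  have "(\<lambda>y. restrict (free_act Q y) (path_space Q)) ` (leavitt_cong Q `` {x}) = {restrict (free_act Q x) (path_space Q)}"
  proof -
    have "restrict (free_act Q y) (path_space Q) = restrict (free_act Q x) (path_space Q)" if "(x, y) \<in> leavitt_cong Q" for y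
      using that ideal_act[OF assms(1), of "x - y"]
      by (auto simp: restrict_def pres_cong_def free_act_diff)
    moreover have "(x, x) \<in> leavitt_cong Q" using assms(2) by (simp add: pres_cong_def gen_ideal.zero)
    ultimately show ?thesis by (intro image_singletonI[where x = x]) blast+
  qed
  then show ?thesis by (simp add: path_rep_def)
qed

lemma UN_class:
  assumes "equiv A r" "x \<in> A" "y \<in> A"
    "\<And>x' y'. (x,x') \<in> r \<Longrightarrow> (y,y') \<in> r \<Longrightarrow> (f x y, f x' y') \<in> r"
  shows "(\<Union>x'\<in>r``{x}. \<Union>y'\<in>r``{y}. r `` {f x' y'}) = r `` {f x y}"
proof -
  have "r `` {f x' y'} = r `` {f x y}" if "(x,x') \<in> r" "(y,y') \<in> r" for x' y'
    using assms(4)[OF that] assms(1) by (metis equiv_class_eq)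
  moreover have "(x,x) \<in> r" "(y,y) \<in> r" using assms by (auto simp: equiv_def refl_on_def)
  ultimately show ?thesis by blast
qed

lemma leavitt_ops:
  fixes x y :: "('v, 'a) lgen word \<Rightarrow>\<^sub>0 'k::field"
  assumes "x \<in> leavitt_free Q" "y \<in> leavitt_free Q"
  shows "aadd (leavitt Q) (leavitt_cong Q `` {x}) (leavitt_cong Q `` {y}) = leavitt_cong Q `` {x + y}"
    and "amult (leavitt Q) (leavitt_cong Q `` {x}) (leavitt_cong Q `` {y}) = leavitt_cong Q `` {x * y}"
    and "ascale (leavitt Q) c (leavitt_cong Q `` {x}) = leavitt_cong Q `` {fscale c x}"
proof -
  note e = equiv_pres_cong[of "leavitt_gens Q" "leavitt_relators Q"]
  have "aadd (leavitt Q) (leavitt_cong Q `` {x}) (leavitt_cong Q `` {y}) =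
    (\<Union>x'\<in>leavitt_cong Q``{x}. \<Union>y'\<in>leavitt_cong Q``{y}. leavitt_cong Q `` {x' + y'})"
    by (simp add: leavitt_def presented_alg_def)
  also have "\<dots> = leavitt_cong Q `` {x + y}"
    using assms
    apply (intro UN_class[OF e])
      apply (auto simp: pres_cong_def leavitt_free_ops)
    by (metis (no_types) add_diff_add gen_ideal.add)
  finally show "aadd (leavitt Q) (leavitt_cong Q `` {x}) (leavitt_cong Q `` {y}) = leavitt_cong Q `` {x + y}" .
  have "amult (leavitt Q) (leavitt_cong Q `` {x}) (leavitt_cong Q `` {y}) =
    (\<Union>x'\<in>leavitt_cong Q``{x}. \<Union>y'\<in>leavitt_cong Q``{y}. leavitt_cong Q `` {x' * y'})"
    by (simp add: leavitt_def presented_alg_def)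
  also have "\<dots> = leavitt_cong Q `` {x * y}"
  proof (intro UN_class[OF e] assms)
    fix x' y' assume h: "(x,x') \<in> leavitt_cong Q" "(y,y') \<in> leavitt_cong Q"
    have "x * y - x' * y' = (x - x') * y + x' * (y - y')" by (simp add: algebra_simps)
    then show "(x * y, x' * y') \<in> leavitt_cong Q"
      using h by (auto simp: pres_cong_def intro: leavitt_free_mult intro: gen_ideal.add gen_ideal.left gen_ideal.right)
  qed
  finally show "amult (leavitt Q) (leavitt_cong Q `` {x}) (leavitt_cong Q `` {y}) = leavitt_cong Q `` {x * y}" .
  have "ascale (leavitt Q) c (leavitt_cong Q `` {x}) = (\<Union>x'\<in>leavitt_cong Q``{x}. \<Union>y'\<in>leavitt_cong Q``{x}. leavitt_cong Q `` {fscale c x'})"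
    using e assms by (auto simp: leavitt_def presented_alg_def)
  also have "\<dots> = leavitt_cong Q `` {fscale c x}"
    using assms
    apply (intro UN_class[OF e])
      apply (auto simp: pres_cong_def leavitt_free_ops)
    by (metis fvs.scale_right_diff_distrib gen_ideal.scale)
  finally show "ascale (leavitt Q) c (leavitt_cong Q `` {x}) = leavitt_cong Q `` {fscale c x}" .
qed

lemma leavitt_carrier: "acarrier (leavitt Q) = leavitt_free Q // leavitt_cong Q"
  by (simp add: leavitt_def presented_alg_def)

lemma path_rep_is_rep:
  fixes Q :: "('a, 'b) pre_digraph"
  assumes "wf_digraph Q"
  shows "is_rep (leavitt Q) (path_rep Q :: ('d::field, _, _) rep)"
  unfolding is_rep_def
proof (intro conjI)
  show "vector_space (rscale (path_rep Q))"
    by (simp add: path_rep_def fvs.vector_space_axioms)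
  show "module.subspace (rscale (path_rep Q)) (rspace (path_rep Q))"
    by (simp add: path_rep_def free_space_subspace)
  have s: "rspace (path_rep Q) = path_space Q" "rscale (path_rep Q) = fscale" by (simp_all add: path_rep_def)
  have F: "f + h \<in> path_space Q" "fscale c f \<in> path_space Q" if "f \<in> path_space Q" "h \<in> path_space Q" for f h :: "_ \<Rightarrow>\<^sub>0 'd::field" and c
    using that by (auto intro: fvs.subspace_add fvs.subspace_scale free_space_subspace)
  show "ract (path_rep Q :: ('d, _, _) rep) \<in> alg_hom (leavitt Q) (End_alg (rscale (path_rep Q)) (rspace (path_rep Q)))"
    unfolding alg_hom_def s leavitt_carrier mem_Collect_eq
  proof (intro conjI ballI allI funcsetI; (erule quotientE)+; hypsubst)
    fix x :: "('a, 'b) lgen word \<Rightarrow>\<^sub>0 'd" and c :: 'd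
    assume x: "x \<in> leavitt_free Q"
    show "ract (path_rep Q) (leavitt_cong Q `` {x}) \<in> acarrier (End_alg fscale (path_space Q))"
      unfolding ract_class[OF assms x] End_alg_def lin_maps_def
      by (simp add: F free_act_add2 free_act_scale2 free_act_in x)
    show "ract (path_rep Q) (ascale (leavitt Q) c (leavitt_cong Q `` {x})) =
        ascale (End_alg fscale (path_space Q)) c (ract (path_rep Q) (leavitt_cong Q `` {x}))"
      unfolding leavitt_ops(3)[OF x x] ract_class[OF assms x] ract_class[OF assms leavitt_free_ops(2)[OF x]]
      by (rule ext) (simp add: End_alg_def free_act_scale)
    fix y :: "('a, 'b) lgen word \<Rightarrow>\<^sub>0 'd"
    assume y: "y \<in> leavitt_free Q"
    show "ract (path_rep Q) (aadd (leavitt Q) (leavitt_cong Q `` {x}) (leavitt_cong Q `` {y})) =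
        aadd (End_alg fscale (path_space Q)) (ract (path_rep Q) (leavitt_cong Q `` {x})) (ract (path_rep Q) (leavitt_cong Q `` {y}))"
      unfolding leavitt_ops(1)[OF x y] ract_class[OF assms x] ract_class[OF assms y]
         ract_class[OF assms leavitt_free_ops(1)[OF x y]]
      by (rule ext) (simp add: End_alg_def free_act_add)
    show "ract (path_rep Q) (amult (leavitt Q) (leavitt_cong Q `` {x}) (leavitt_cong Q `` {y})) =
        amult (End_alg fscale (path_space Q)) (ract (path_rep Q) (leavitt_cong Q `` {x})) (ract (path_rep Q) (leavitt_cong Q `` {y}))"
      unfolding leavitt_ops(2)[OF x y] ract_class[OF assms x] ract_class[OF assms y]
         ract_class[OF assms leavitt_free_mult[OF x y]]
      by (rule ext) (simp add: End_alg_def free_act_mult compose_def free_act_in y)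
  qed
qed

definition leavitt_gen ::
    "('v, 'a) pre_digraph \<Rightarrow> ('v, 'a) lgen \<Rightarrow> (('v, 'a) lgen word \<Rightarrow>\<^sub>0 'k::field) set" where
  "leavitt_gen Q g = leavitt_cong Q `` {word_vec [g]}"

lemma path_rep_gen:
  assumes "wf_digraph Q" "g \<in> leavitt_gens Q" "p \<in> inf_paths Q"
  shows "leavitt_gen Q g \<in> acarrier (leavitt Q)"
    "ract (path_rep Q) (leavitt_gen Q g) (basis_vec p) = gen_act Q g p"
proof -
  have *: "word_vec [g] \<in> leavitt_free Q" using assms(2) by (simp add: free_alg_carrier_def)
  show "leavitt_gen Q g \<in> acarrier (leavitt Q)"
    using * by (auto simp: leavitt_gen_def leavitt_carrier intro: quotientI)
  show "ract (path_rep Q) (leavitt_gen Q g) (basis_vec p) = gen_act Q g p"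
    unfolding leavitt_gen_def ract_class[OF assms(1) *]
    by (simp only: restrict_apply basis_vec_in_free_space assms(3) if_True
      free_act_basis word_act_Word lin_ext_basis_vec)
qed

lemma class_space_alt: "class_space c = (free_space c :: (_ \<Rightarrow>\<^sub>0 'k::field) set)"
  unfolding class_space_def
proof (rule fvs.span_unique)
  show "basis_vec ` c \<subseteq> free_space c" by auto
  show "fvs.subspace (free_space c)" by (rule free_space_subspace)
  fix T :: "(_ \<Rightarrow>\<^sub>0 'k::field) set" assume T: "basis_vec ` c \<subseteq> T" "fvs.subspace T"
  show "free_space c \<subseteq> T"
  proof
    fix f :: "_ \<Rightarrow>\<^sub>0 'k" assume "f \<in> free_space c"
    then show "f \<in> T" by (induction rule: free_space_induct)
      (use T in \<open>auto intro: fvs.subspace_0 fvs.subspace_add fvs.subspace_scale\<close>)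
  qed
qed

end

theory Submission
  imports Defs
begin

text \<open>
  For tail-equivalent paths \<open>p = wu\<close> and \<open>q = wv\<close> (with \<open>u\<close>, \<open>v\<close> the finite initial parts) the
  element \<open>v\<^sup>*u\<close> of the Leavitt path algebra sends \<open>p\<close> to \<open>q\<close> and kills every path that does not
  begin with \<open>u\<close>.  Enlarging \<open>u\<close> and \<open>v\<close> along \<open>w\<close>, it kills any prescribed finite set of
  paths other than \<open>p\<close>, so on vectors supported there it acts as the matrix unit \<open>f \<mapsto> f(p) q\<close>.
  Hence a nonzero subrepresentation of a tail class contains one and then all of its paths.
  A homomorphism \<open>\<phi>\<close> between classes commutes with these matrix units, so \<open>\<phi> q = \<phi>(p)(p) q\<close>
  for all \<open>q\<close> tail-equivalent to \<open>p\<close>: it is a scalar, and zero if the classes differ.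
\<close>

section \<open>Restriction to a subrepresentation\<close>

text \<open>Stability of \<open>N\<close> keeps the restricted operators inside \<open>N\<close>, so
  composing two restrictions is the same as restricting the composite.\<close>

lemma is_rep_subrep:
  assumes "is_subrep A V N"
  shows "is_rep A (subrep V N)"
proof -
  have V: "vector_space (rscale V)" "ract V \<in> alg_hom A (End_alg (rscale V) (rspace V))"
    and N: "module.subspace (rscale V) N" "N \<subseteq> rspace V"
      "\<And>a x. a \<in> acarrier A \<Longrightarrow> x \<in> N \<Longrightarrow> ract V a x \<in> N"
    using assms by (auto simp: is_subrep_def is_rep_def)
  interpret vector_space "rscale V" by (rule V)
  have add: "x + y \<in> N" if "x \<in> N" "y \<in> N" for x y
    using subspace_add[OF N(1)] that .
  have scale: "rscale V c x \<in> N" if "x \<in> N" for c x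
    using subspace_scale[OF N(1)] that .
  show ?thesis
    unfolding is_rep_def
  proof (intro conjI)
    show "vector_space (rscale (subrep V N))"
      using V(1) by (simp add: subrep_def)
    show "module.subspace (rscale (subrep V N)) (rspace (subrep V N))"
      using N(1) by (simp add: subrep_def)
    show "ract (subrep V N) \<in> alg_hom A (End_alg (rscale (subrep V N)) (rspace (subrep V N)))"
      using V(2) N(2,3) add scale
      by (auto simp: alg_hom_def End_alg_def lin_maps_def subrep_def Pi_iff restrict_def
          compose_def fun_eq_iff subset_iff)
  qed
qed

section \<open>Prefixes and tails of paths\<close>

text \<open>Each \<open>r\<close> other than \<open>p\<close> differs from \<open>p\<close> at some
  position and hence on all longer prefixes; finiteness of \<open>S\<close> yields one bound for all
  \<open>r\<close>. This makes a single prefix length work for a whole finite support.\<close>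

lemma eventually_stake_neq:
  assumes "finite S"
  shows "\<forall>\<^sub>F n in sequentially. \<forall>r\<in>S. r \<noteq> p \<longrightarrow> stake n r \<noteq> stake n p"
proof (rule eventually_ball_finite[OF assms], rule ballI)
  fix r
  show "\<forall>\<^sub>F n in sequentially. r \<noteq> p \<longrightarrow> stake n r \<noteq> stake n p"
  proof (cases "r = p")
    case False
    \<comment> \<open>Streams that agree at every position are equal; this is
      \<open>smap_alt\<close> for the identity map.\<close>
    then obtain i where i: "r !! i \<noteq> p !! i"
      by (metis ext smap_alt stream.map_id)
    have "stake n r \<noteq> stake n p" if "n \<ge> Suc i" for n
      using i that by (metis Suc_le_eq stake_nth)
    then show ?thesis
      by (auto simp: eventually_sequentially)
  qed simp
qed

lemma equiv_tail_equiv: "equiv (inf_paths Q) (tail_equiv Q)"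
proof (rule equivI)
  show "tail_equiv Q \<subseteq> inf_paths Q \<times> inf_paths Q"
    by (auto simp: tail_equiv_def)
  show "refl_on (inf_paths Q) (tail_equiv Q)"
    by (auto simp: refl_on_def tail_equiv_def)
  show "sym (tail_equiv Q)"
    by (auto simp: sym_def tail_equiv_def) metis
  show "trans (tail_equiv Q)"
  proof (rule transI)
    fix p q r
    assume pq: "(p, q) \<in> tail_equiv Q" and qr: "(q, r) \<in> tail_equiv Q"
    obtain n m where nm: "sdrop n p = sdrop m q"
      using pq by (auto simp: tail_equiv_def)
    obtain k l where kl: "sdrop k q = sdrop l r"
      using qr by (auto simp: tail_equiv_def)
    \<comment> \<open>Both sides equal \<open>sdrop (m + k) q\<close>.\<close>
    have "sdrop (n + k) p = sdrop (l + m) r"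
      by (metis add.commute kl nm sdrop_add)
    then show "(p, r) \<in> tail_equiv Q"
      using pq qr unfolding tail_equiv_def by blast
  qed
qed

lemma tail_classD:
  assumes "c \<in> tail_classes Q"
  shows "c \<subseteq> inf_paths Q" "c \<noteq> {}" "p \<in> c \<Longrightarrow> q \<in> c \<Longrightarrow> (p, q) \<in> tail_equiv Q"
    "p \<in> c \<Longrightarrow> (p, q) \<in> tail_equiv Q \<Longrightarrow> q \<in> c"
  using assms equiv_tail_equiv[of Q] unfolding tail_classes_def
  by (auto dest: in_quotient_imp_subset in_quotient_imp_non_empty in_quotient_imp_in_rel
      in_quotient_imp_closed)

lemma tail_equiv_stl: "p \<in> inf_paths Q \<Longrightarrow> (p, stl p) \<in> tail_equiv Q"
  unfolding tail_equiv_def mem_Collect_eq case_prod_conv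
  by (intro conjI exI[of _ "Suc 0"] exI[of _ 0]) (simp_all add: inf_paths_stl)

lemma tail_equiv_Cons:
  "p \<in> inf_paths Q \<Longrightarrow> a \<in> arcs Q \<Longrightarrow> head Q a = path_source Q p \<Longrightarrow> (p, a ## p) \<in> tail_equiv Q"
  using inf_paths_Cons[of p Q a] tail_equiv_stl[of "a ## p" Q] equiv_tail_equiv[of Q]
  by (auto elim: equivE dest: symD)

section \<open>Matrix units in the Leavitt path algebra\<close>

text \<open>The last letter of a word acts first, so \<open>rev\<close> lets the arrows of
  \<open>p\<close> strip \<open>r\<close> from its beginning. A single mismatch gives 0, and the
  remaining letters preserve it.\<close>

lemma down_act:
  "foldr (\<lambda>g. lin_ext (gen_act Q g)) (rev (map Arr (stake n p))) (basis_vec r)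
    = (if stake n r = stake n p then basis_vec (sdrop n r) else (0 :: _ \<Rightarrow>\<^sub>0 'k::field))"
proof (induction n arbitrary: p r)
  case (Suc n)
  have zero: "foldr (\<lambda>g. lin_ext (gen_act Q g)) gs 0 = (0 :: _ \<Rightarrow>\<^sub>0 'k)" for gs
    by (induction gs) auto
  show ?case
    using Suc.IH[of "stl p" "stl r"] zero by auto
qed simp

text \<open>Here the word is not reversed: the prefix is rebuilt starting with the arrow adjacent to
  \<open>sdrop n p\<close>. Consecutive arrows of \<open>p\<close> match, so no ghost letter gives
  0.\<close>

lemma up_act:
  "p \<in> inf_paths Q \<Longrightarrow> foldr (\<lambda>g. lin_ext (gen_act Q g)) (map Ghost (stake n p)) (basis_vec (sdrop n p))
    = (basis_vec p :: _ \<Rightarrow>\<^sub>0 'k::field)"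
  by (induction n arbitrary: p) (auto simp: inf_paths_stl inf_paths_head)

text \<open>The hypothesis concerns only the support of \<open>f\<close>, because the algebra
  elements constructed below act as matrix units only on vectors supported in a prescribed finite
  set.\<close>

lemma lin_ext_delta:
  assumes "\<And>b. b \<in> Poly_Mapping.keys f \<Longrightarrow> g b = (if b = p then v else 0)"
  shows "lin_ext g f = fscale (Poly_Mapping.lookup f p) v"
proof -
  have "lin_ext g f = (\<Sum>b\<in>Poly_Mapping.keys f. if b = p then fscale (Poly_Mapping.lookup f p) v else 0)"
    unfolding lin_ext_def by (rule sum.cong) (auto simp: assms)
  then show ?thesis
    by (simp add: in_keys_iff)
qed

lemma free_act_lin_ext: "free_act Q x f = lin_ext (\<lambda>b. free_act Q x (basis_vec b)) f"
  using free_space_UNIV[of f]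
  by (induction rule: free_space_induct)
    (simp_all only: free_act_zero2 lin_ext_zero lin_ext_basis_vec free_act_scale2 lin_ext_scale
      free_act_add2 lin_ext_add)

lemma matrix_unit:
  fixes Q :: "('v, 'a) pre_digraph"
  assumes pq: "(p, q) \<in> tail_equiv Q" and S: "finite S"
  obtains x :: "('v, 'a) lgen word \<Rightarrow>\<^sub>0 'k::field"
  where "x \<in> leavitt_free Q"
    "\<And>f. Poly_Mapping.keys f \<subseteq> S \<Longrightarrow> free_act Q x f = fscale (Poly_Mapping.lookup f p) (basis_vec q)"
proof -
  from pq obtain n m where p: "p \<in> inf_paths Q" and q: "q \<in> inf_paths Q" and nm: "sdrop n p = sdrop m q"
    by (auto simp: tail_equiv_def)
  obtain k where k: "\<And>n r. n \<ge> k \<Longrightarrow> r \<in> S \<Longrightarrow> r \<noteq> p \<Longrightarrow> stake n r \<noteq> stake n p"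
    using eventually_stake_neq[OF S, of p] by (auto simp: eventually_sequentially)
  \<comment> \<open>Adding the same amount to \<open>n\<close> and \<open>m\<close> keeps the common
    tail. The bound \<open>N \<ge> k\<close> separates \<open>p\<close> from the rest of
    \<open>S\<close>, and the extra \<open>Suc\<close> makes \<open>w\<close> nonempty, as
    membership in the non-unital free algebra demands.\<close>
  define N M where "N = n + Suc k" and "M = m + Suc k"
  have NM: "sdrop N p = sdrop M q"
    unfolding N_def M_def by (metis nm sdrop_add)
  define w :: "('v, 'a) lgen word" where "w = Word (map Ghost (stake M q) @ rev (map Arr (stake N p)))"
  have arcs: "set (stake N p) \<subseteq> arcs Q" "set (stake M q) \<subseteq> arcs Q"
    using p q by (auto simp: inf_paths_def in_set_conv_nth subset_iff)
  have free: "basis_vec w \<in> leavitt_free Q"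
    using arcs unfolding leavitt_gens_def
    by (auto simp: free_alg_carrier_def w_def N_def image_iff subset_iff simp del: stake.simps)
  have act: "free_act Q (basis_vec w) (basis_vec r) = (if r = p then basis_vec q else (0 :: _ \<Rightarrow>\<^sub>0 'k))"
    if "r \<in> S" for r
  proof (cases "r = p")
    case True
    then show ?thesis
      using up_act[OF q, of M] by (simp add: word_act_def w_def down_act NM del: map_append foldr_map)
  next
    case False
    with k[OF _ that, of N] have "stake N r \<noteq> stake N p"
      by (simp add: N_def)
    with False show ?thesis
      using word_act_linear(3)[of Q "Word (map Ghost (stake M q))"]
      by (simp add: word_act_def w_def down_act del: foldr_map)
  qed
  show ?thesis
    by (rule that[OF free], subst free_act_lin_ext, rule lin_ext_delta, rule act) blast
qed

section \<open>Tail classes as subrepresentations\<close>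

text \<open>A generator fixes a path, removes its first arrow, prepends an arrow, or kills it; none
  of these leads out of the tail class. Words and their linear combinations inherit this.\<close>

lemma class_space_invariant:
  assumes c: "c \<in> tail_classes Q" and x: "x \<in> leavitt_free Q" and f: "f \<in> free_space c"
  shows "free_act Q x f \<in> free_space c"
proof -
  have gen: "gen_act Q g p \<in> free_space c" if g: "g \<in> leavitt_gens Q" and p: "p \<in> c" for g p
  proof -
    have pQ: "p \<in> inf_paths Q" using tail_classD(1)[OF c] p by blast
    have "stl p \<in> c"
      by (rule tail_classD(4)[OF c p tail_equiv_stl[OF pQ]])
    moreover have "a ## p \<in> c" if "a \<in> arcs Q" "head Q a = path_source Q p" for a
      by (rule tail_classD(4)[OF c p tail_equiv_Cons[OF pQ that]])
    ultimately show ?thesis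
      using g p by (cases g) (auto simp: leavitt_gens_def intro: fvs.subspace_0 free_space_subspace)
  qed
  have "foldr (\<lambda>g. lin_ext (gen_act Q g)) gs f \<in> free_space c" if "gs \<in> lists (leavitt_gens Q)" for gs
    using that by (induction gs) (auto intro!: lin_ext_in gen f)
  then show ?thesis
    using x unfolding free_act_def free_alg_carrier_def
    by (elim lin_ext_in) (auto simp: word_act_def)
qed

lemma class_rep_simps:
  "rscale (class_rep Q c) = fscale" "rspace (class_rep Q c) = free_space c"
  by (simp_all add: class_rep_def subrep_def path_rep_def class_space_alt)

lemma free_space_mono: "B \<subseteq> C \<Longrightarrow> free_space B \<subseteq> free_space C"
  by (auto simp: free_space_def)

lemma ract_class_rep:
  assumes "wf_digraph Q" "c \<in> tail_classes Q" "x \<in> leavitt_free Q" "f \<in> free_space c"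
  shows "ract (class_rep Q c) (leavitt_cong Q `` {x}) f = free_act Q x f"
  using assms(4) free_space_mono[OF tail_classD(1)[OF assms(2)]]
  by (auto simp: class_rep_def subrep_def class_space_alt ract_class[OF assms(1,3)])

lemma is_subrep_class_space:
  fixes Q :: "('v, 'a) pre_digraph"
  assumes "wf_digraph Q" "c \<in> tail_classes Q"
  shows "is_subrep (leavitt Q) (path_rep Q) (class_space c :: (_ \<Rightarrow>\<^sub>0 'k::field) set)"
  unfolding is_subrep_def class_space_alt leavitt_carrier
proof (intro conjI ballI)
  have sub: "free_space c \<subseteq> (path_space Q :: (_ \<Rightarrow>\<^sub>0 'k) set)"
    by (rule free_space_mono[OF tail_classD(1)[OF assms(2)]])
  show "is_rep (leavitt Q) (path_rep Q :: ('k, _, _) rep)"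
    by (rule path_rep_is_rep[OF assms(1)])
  show "module.subspace (rscale (path_rep Q)) (free_space c :: (_ \<Rightarrow>\<^sub>0 'k) set)"
    by (simp add: path_rep_def free_space_subspace)
  show "free_space c \<subseteq> rspace (path_rep Q :: ('k, _, _) rep)"
    using sub by (simp add: path_rep_def)
  fix X :: "(('v, 'a) lgen word \<Rightarrow>\<^sub>0 'k) set" and f :: "'a stream \<Rightarrow>\<^sub>0 'k"
  assume "X \<in> leavitt_free Q // leavitt_cong Q" and f: "f \<in> free_space c"
  then obtain x where x: "x \<in> leavitt_free Q" "X = leavitt_cong Q `` {x}"
    by (elim quotientE)
  show "ract (path_rep Q) X f \<in> free_space c"
    using class_space_invariant[OF assms(2) x(1) f] f sub
    by (auto simp: x(2) ract_class[OF assms(1) x(1)])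
qed

section \<open>Irreducibility\<close>

lemma subspace_eq_free_space:
  fixes N :: "('b \<Rightarrow>\<^sub>0 'k::field) set"
  assumes "fvs.subspace N" "N \<subseteq> free_space c" "\<And>p. p \<in> c \<Longrightarrow> basis_vec p \<in> N"
  shows "N = free_space c"
proof
  show "free_space c \<subseteq> N"
  proof
    fix f :: "'b \<Rightarrow>\<^sub>0 'k"
    assume "f \<in> free_space c"
    then show "f \<in> N"
      by (induction rule: free_space_induct)
        (use assms in \<open>auto intro: fvs.subspace_0 fvs.subspace_add fvs.subspace_scale\<close>)
  qed
qed (rule assms)

lemma basis_vec_neq_0: "(basis_vec b :: _ \<Rightarrow>\<^sub>0 'k::field) \<noteq> 0"
  by (simp add: basis_vec_def flip: keys_eq_empty)

lemma class_rep_irreducible: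
  fixes Q :: "('v, 'a) pre_digraph"
  assumes Q: "wf_digraph Q" and c: "c \<in> tail_classes Q"
  shows "irreducible_rep (leavitt Q) (class_rep Q c :: ('k::field, _, _) rep)"
  unfolding irreducible_rep_def
proof (intro conjI allI impI)
  show "is_rep (leavitt Q) (class_rep Q c :: ('k, _, _) rep)"
    unfolding class_rep_def by (rule is_rep_subrep[OF is_subrep_class_space[OF Q c]])
  obtain p where p: "p \<in> c" using tail_classD(2)[OF c] by blast
  have "basis_vec p \<in> (free_space c :: (_ \<Rightarrow>\<^sub>0 'k) set)"
    using p by simp
  then show "rspace (class_rep Q c :: ('k, _, _) rep) \<noteq> {0}"
    using basis_vec_neq_0[of p, where 'k = 'k] unfolding class_rep_simps by (metis singletonD)
  fix N :: "('a stream \<Rightarrow>\<^sub>0 'k) set"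
  assume "is_subrep (leavitt Q) (class_rep Q c) N"
  then have sub: "fvs.subspace N" and Nc: "N \<subseteq> free_space c"
    and act: "\<And>X f. X \<in> acarrier (leavitt Q) \<Longrightarrow> f \<in> N \<Longrightarrow> ract (class_rep Q c) X f \<in> N"
    by (auto simp: is_subrep_def class_rep_simps)
  show "N = {0} \<or> N = rspace (class_rep Q c)"
  proof (cases "N \<subseteq> {0}")
    case True
    then show ?thesis using fvs.subspace_0[OF sub] by blast
  next
    case False
    then obtain f where f: "f \<in> N" "f \<noteq> 0" by blast
    then obtain r where r: "Poly_Mapping.lookup f r \<noteq> 0"
      by (metis poly_mapping_eqI lookup_zero)
    then have rc: "r \<in> c" using f Nc by (auto simp: free_space_def in_keys_iff subset_iff)
    have "basis_vec q \<in> N" if q: "q \<in> c" for q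
    proof -
      \<comment> \<open>The finite set is the whole support of \<open>f\<close>, so \<open>x\<close>
        isolates the coefficient at \<open>r\<close> and moves it to \<open>q\<close>.\<close>
      obtain x :: "('v, 'a) lgen word \<Rightarrow>\<^sub>0 'k" where x: "x \<in> leavitt_free Q"
        and xf: "free_act Q x f = fscale (Poly_Mapping.lookup f r) (basis_vec q)"
        by (rule matrix_unit[OF tail_classD(3)[OF c rc q] finite_keys[of f]]) blast
      have "ract (class_rep Q c) (leavitt_cong Q `` {x}) f \<in> N"
        by (rule act) (use x f in \<open>auto simp: leavitt_carrier intro: quotientI\<close>)
      then have "fscale (Poly_Mapping.lookup f r) (basis_vec q) \<in> N"
        using f Nc by (subst (asm) ract_class_rep[OF Q c x]) (auto simp: xf)
      \<comment> \<open>The coefficient of \<open>f\<close> at \<open>r\<close> is nonzero, so it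
        can be divided out.\<close>
      from fvs.subspace_scale[OF sub this, of "inverse (Poly_Mapping.lookup f r)"] r
      show ?thesis by simp
    qed
    then show ?thesis
      using subspace_eq_free_space[OF sub Nc] by (simp add: class_rep_simps)
  qed
qed

section \<open>Homomorphisms between tail classes\<close>

text \<open>Allowing two classes serves both claims: for \<open>c = d\<close> it determines the
  endomorphisms, while for \<open>p\<close> outside \<open>d\<close> the coefficient of
  \<open>\<phi> (basis_vec p)\<close> at \<open>p\<close> vanishes, forcing \<phi> to be zero on the
  class space of \<open>c\<close>.\<close>

lemma class_rep_hom_scalar:
  fixes Q :: "('v, 'a) pre_digraph"
    and \<phi> :: "('a stream \<Rightarrow>\<^sub>0 'k::field) \<Rightarrow> ('a stream \<Rightarrow>\<^sub>0 'k)"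
  assumes Q: "wf_digraph Q" and c: "c \<in> tail_classes Q" and d: "d \<in> tail_classes Q"
    and \<phi>: "\<phi> \<in> rep_homs (leavitt Q) (class_rep Q c) (class_rep Q d)"
    and p: "p \<in> c" and f: "f \<in> free_space c"
  shows "\<phi> f = fscale (Poly_Mapping.lookup (\<phi> (basis_vec p)) p) f"
proof -
  have \<phi>_in: "\<phi> f \<in> free_space d" if "f \<in> free_space c" for f
    using \<phi> that by (auto simp: rep_homs_def lin_maps_def class_rep_simps)
  have \<phi>_add: "\<phi> (f + g) = \<phi> f + \<phi> g" if "f \<in> free_space c" "g \<in> free_space c" for f g
    using \<phi> that by (auto simp: rep_homs_def lin_maps_def class_rep_simps)
  have \<phi>_scale: "\<phi> (fscale b f) = fscale b (\<phi> f)" if "f \<in> free_space c" for b f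
    using \<phi> that by (auto simp: rep_homs_def lin_maps_def class_rep_simps)
  have \<phi>_act: "\<phi> (free_act Q x f) = free_act Q x (\<phi> f)"
    if x: "x \<in> leavitt_free Q" and f: "f \<in> free_space c" for x f
  proof -
    have "leavitt_cong Q `` {x} \<in> acarrier (leavitt Q)"
      using x by (auto simp: leavitt_carrier intro: quotientI)
    then have "\<phi> (ract (class_rep Q c) (leavitt_cong Q `` {x}) f)
        = ract (class_rep Q d) (leavitt_cong Q `` {x}) (\<phi> f)"
      using \<phi> f by (auto simp: rep_homs_def class_rep_simps)
    then show ?thesis
      by (simp only: ract_class_rep[OF Q c x f] ract_class_rep[OF Q d x \<phi>_in[OF f]])
  qed
  have basis: "\<phi> (basis_vec q) = fscale (Poly_Mapping.lookup (\<phi> (basis_vec p)) p) (basis_vec q)"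
    if q: "q \<in> c" for q
  proof -
    \<comment> \<open>One element \<open>x\<close> must act as a matrix unit on
      \<open>basis_vec p\<close> and on its image under \<phi>, so \<open>?S\<close> covers both
      supports.\<close>
    let ?S = "insert p (Poly_Mapping.keys (\<phi> (basis_vec p)))"
    obtain x :: "('v, 'a) lgen word \<Rightarrow>\<^sub>0 'k" where x: "x \<in> leavitt_free Q"
      and xf: "\<And>f. Poly_Mapping.keys f \<subseteq> ?S \<Longrightarrow>
        free_act Q x f = fscale (Poly_Mapping.lookup f p) (basis_vec q)"
      by (rule matrix_unit[OF tail_classD(3)[OF c p q], of ?S]) auto
    have "free_act Q x (basis_vec p) = (basis_vec q :: _ \<Rightarrow>\<^sub>0 'k)"
      by (subst xf) (auto simp: basis_vec_def)
    then have "\<phi> (basis_vec q) = free_act Q x (\<phi> (basis_vec p))"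
      using \<phi>_act[OF x, of "basis_vec p"] p by simp
    then show ?thesis
      by (subst (asm) xf) auto
  qed
  have zero: "\<phi> 0 = 0"
    using \<phi>_scale[of 0 0] fvs.subspace_0[OF free_space_subspace, of c] by simp
  \<comment> \<open>Membership is carried through the induction because additivity of \<phi> is
    available only on \<open>free_space c\<close>, and the sum case supplies no membership by
    itself.\<close>
  have "f \<in> free_space c \<and> \<phi> f = fscale (Poly_Mapping.lookup (\<phi> (basis_vec p)) p) f"
    using f
  proof (induction rule: free_space_induct)
    case (add f g)
    then show ?case
      by (simp add: \<phi>_add fvs.scale_right_distrib fvs.subspace_add[OF free_space_subspace])
  next
    case (scale b f)
    then show ?case
      by (simp add: \<phi>_scale mult.commute fvs.subspace_scale[OF free_space_subspace])
  qed (simp_all add: zero basis fvs.subspace_0[OF free_space_subspace])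
  then show ?thesis ..
qed

text \<open>Scalars commute with the linear action. The restriction is there because
  \<open>lin_maps\<close> consists of extensional maps.\<close>

lemma scalar_in_rep_homs:
  fixes Q :: "('v, 'a) pre_digraph" and b :: "'k::field"
  assumes Q: "wf_digraph Q" and c: "c \<in> tail_classes Q"
  shows "restrict (fscale b) (free_space c)
    \<in> rep_homs (leavitt Q) (class_rep Q c) (class_rep Q c)"
  unfolding rep_homs_def lin_maps_def class_rep_simps leavitt_carrier
proof (intro CollectI conjI ballI allI)
  fix X :: "(('v, 'a) lgen word \<Rightarrow>\<^sub>0 'k) set" and f :: "'a stream \<Rightarrow>\<^sub>0 'k"
  assume X: "X \<in> leavitt_free Q // leavitt_cong Q" and f: "f \<in> free_space c"
  from X obtain x where x: "x \<in> leavitt_free Q" "X = leavitt_cong Q `` {x}"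
    by (elim quotientE)
  have bf: "fscale b f \<in> free_space c"
    using f by (rule fvs.subspace_scale[OF free_space_subspace])
  show "restrict (fscale b) (free_space c) (ract (class_rep Q c) X f)
      = ract (class_rep Q c) X (restrict (fscale b) (free_space c) f)"
    using f class_space_invariant[OF c x(1) f]
    by (simp add: x(2) ract_class_rep[OF Q c x(1)] bf free_act_scale2)
qed (auto simp: fvs.scale_right_distrib mult.commute
    intro: fvs.subspace_add fvs.subspace_scale free_space_subspace)

text \<open>An endomorphism is multiplication by its diagonal coefficient at any fixed
  \<open>p\<close> in the class; reading off this coefficient is inverse to sending a scalar to its
  multiplication map.\<close>

lemma rep_End_class_rep:
  fixes Q :: "('v, 'a) pre_digraph"
  assumes Q: "wf_digraph Q" and c: "c \<in> tail_classes Q"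
  shows "alg_isomorphic (rep_End (leavitt Q) (class_rep Q c :: ('k::field, _, _) rep)) field_alg"
proof -
  obtain p where p: "p \<in> c" using tail_classD(2)[OF c] by blast
  let ?H = "rep_homs (leavitt Q) (class_rep Q c) (class_rep Q c :: ('k, _, _) rep)"
  define h :: "(('a stream \<Rightarrow>\<^sub>0 'k) \<Rightarrow> ('a stream \<Rightarrow>\<^sub>0 'k)) \<Rightarrow> 'k"
    where "h \<phi> = Poly_Mapping.lookup (\<phi> (basis_vec p)) p" for \<phi>
  have bp: "basis_vec p \<in> (free_space c :: (_ \<Rightarrow>\<^sub>0 'k) set)" "Poly_Mapping.lookup (basis_vec p) p = (1 :: 'k)"
    using p by simp (simp add: basis_vec_def)
  have hom: "\<phi> f = fscale (h \<phi>) f" if "\<phi> \<in> ?H" "f \<in> free_space c" for \<phi> f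
    unfolding h_def by (rule class_rep_hom_scalar[OF Q c c that(1) p that(2)])
  have comp: "h (compose (free_space c) \<phi> \<psi>) = h \<phi> * h \<psi>" if "\<phi> \<in> ?H" "\<psi> \<in> ?H" for \<phi> \<psi>
  proof -
    have "\<psi> (basis_vec p) \<in> free_space c"
      using that(2) bp(1) by (auto simp: rep_homs_def lin_maps_def class_rep_simps)
    \<comment> \<open>Taking the coefficient at \<open>p\<close> turns this into multiplicativity of
      \<open>h\<close>.\<close>
    from hom[OF that(1) this]
    have "\<phi> (\<psi> (basis_vec p)) = fscale (h \<phi>) (\<psi> (basis_vec p))" .
    then show ?thesis
      using bp(1) by (metis (no_types) compose_eq h_def lookup_fscale)
  qed
  have "h \<in> alg_hom (rep_End (leavitt Q) (class_rep Q c)) field_alg"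
    using bp comp
    by (auto simp: alg_hom_def rep_End_def End_alg_def field_alg_def class_rep_simps h_def lookup_add)
  moreover have "bij_betw h ?H UNIV"
  proof (rule bij_betw_byWitness[where f' = "\<lambda>b. restrict (fscale b) (free_space c)"])
    show "\<forall>\<phi>\<in>?H. restrict (fscale (h \<phi>)) (free_space c) = \<phi>"
    proof
      fix \<phi> assume \<phi>: "\<phi> \<in> ?H"
      then have "\<phi> \<in> extensional (free_space c)"
        by (auto simp: rep_homs_def lin_maps_def class_rep_simps PiE_def)
      then show "restrict (fscale (h \<phi>)) (free_space c) = \<phi>"
        by (intro extensionalityI[where A = "free_space c"]) (auto simp: hom[OF \<phi>])
    qed
    show "(\<lambda>b. restrict (fscale b) (free_space c)) ` UNIV \<subseteq> ?H"
      using scalar_in_rep_homs[OF Q c] by blast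
  qed (auto simp: h_def bp p)
  ultimately show ?thesis
    unfolding alg_isomorphic_def by (intro bexI[of _ h]) (auto simp: rep_End_def field_alg_def)
qed

lemma class_rep_isomorphic_iff:
  fixes Q :: "('v, 'a) pre_digraph"
  assumes Q: "wf_digraph Q" and c: "c \<in> tail_classes Q" and d: "d \<in> tail_classes Q"
  shows "rep_isomorphic (leavitt Q) (class_rep Q c) (class_rep Q d :: ('k::field, _, _) rep) \<longleftrightarrow> c = d"
proof
  assume "c = d"
  \<comment> \<open>Multiplication by 1 is the identity of the class space and serves as the
    isomorphism.\<close>
  moreover have "bij_betw (restrict (fscale 1) (free_space c)) (free_space c) (free_space c :: (_ \<Rightarrow>\<^sub>0 'k) set)"
    by (auto simp: bij_betw_def inj_on_def)
  ultimately show "rep_isomorphic (leavitt Q) (class_rep Q c) (class_rep Q d :: ('k, _, _) rep)"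
    using scalar_in_rep_homs[OF Q c, of "1 :: 'k"]
    unfolding rep_isomorphic_def class_rep_simps by blast
next
  assume "rep_isomorphic (leavitt Q) (class_rep Q c) (class_rep Q d :: ('k, _, _) rep)"
  then obtain \<phi> where \<phi>: "\<phi> \<in> rep_homs (leavitt Q) (class_rep Q c) (class_rep Q d :: ('k, _, _) rep)"
    and bij: "bij_betw \<phi> (free_space c) (free_space d)"
    by (auto simp: rep_isomorphic_def class_rep_simps)
  obtain p where p: "p \<in> c" using tail_classD(2)[OF c] by blast
  have bp: "basis_vec p \<in> (free_space c :: (_ \<Rightarrow>\<^sub>0 'k) set)" using p by simp
  note scalar = class_rep_hom_scalar[OF Q c d \<phi> p]
  have 0: "0 \<in> (free_space c :: (_ \<Rightarrow>\<^sub>0 'k) set)"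
    by (rule fvs.subspace_0[OF free_space_subspace])
  \<comment> \<open>Injectivity makes the scalar nonzero. As this scalar is also a coefficient at
    \<open>p\<close> of a vector supported in \<open>d\<close>, the path \<open>p\<close> lies in
    both classes, which therefore coincide.\<close>
  have "\<phi> (basis_vec p) \<noteq> \<phi> 0"
    using bij bp 0 basis_vec_neq_0[of p] by (auto simp: bij_betw_def inj_on_def)
  then have "Poly_Mapping.lookup (\<phi> (basis_vec p)) p \<noteq> 0"
    using scalar[OF bp] scalar[OF 0] by auto
  then have "p \<in> d"
    using bij_betwE[OF bij] bp by (auto simp: free_space_def in_keys_iff subset_iff)
  then show "c = d"
    using p tail_classD(3,4)[OF c] tail_classD(3,4)[OF d] by blast
qed

theorem theorem3p2:
  fixes Q :: "('v, 'a) pre_digraph"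
    and L :: "('k::field, (('v, 'a) lgen word \<Rightarrow>\<^sub>0 'k) set) nu_alg"
  assumes "wf_digraph Q"
    and "L = leavitt Q"
  shows "(\<forall>c\<in>tail_classes Q.
            is_subrep L (path_rep Q) (class_space c) \<and>
            irreducible_rep L (class_rep Q c) \<and>
            alg_isomorphic (rep_End L (class_rep Q c)) field_alg) \<and>
         (\<forall>c\<in>tail_classes Q. \<forall>d\<in>tail_classes Q.
            rep_isomorphic L (class_rep Q c) (class_rep Q d) \<longleftrightarrow> c = d)"
  unfolding assms(2)
  using is_subrep_class_space[OF assms(1)] class_rep_irreducible[OF assms(1)]
    rep_End_class_rep[OF assms(1)] class_rep_isomorphic_iff[OF assms(1)]
  by blast

end
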